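(* Each strongly taut, Lindelöf locally small space is paracompact.
   Context: A locally small space is a pair $(X,\mathcal{L}_X)$ with $X$ a set and $\mathcal{L}_X\subseteq\mathcal{P}(X)$ such that $\emptyset\in\mathcal{L}_X$, $L\cap M,L\cup M\in\mathcal{L}_X$ for all $L,M\in\mathcal{L}_X$, and $\bigcup\mathcal{L}_X=X$. Its open sets are the members of $\mathcal{L}_X^o=\{V\subseteq X:V\cap L\in\mathcal{L}_X\ \forall L\in\mathcal{L}_X\}$; its closed sets are the complements $X\setminus V$ of $V\in\mathcal{L}_X^o$; its small sets are the subsets of members of $\mathcal{L}_X$. The weak closure of $Y\subseteq X$ is the closure of $Y$ in the topology $\mathcal{L}_X^{wo}=\{\bigcup\mathcal{U}:\mathcal{U}\subseteq\mathcal{L}_X\}$. A family $\mathcal{U}\subseteq\mathcal{L}_X^o$ is locally finite if each member of $\mathcal{L}_X$ has non-empty intersection with only finitely many members of $\mathcal{U}$; it is admissible if for each $L\in\mathcal{L}_X$ there is a finite $\mathcal{U}_L\subseteq\mathcal{U}$ with $(\bigcup\mathcal{U})\cap L=(\bigcup\mathcal{U}_L)\cap L$. The space is: strongly taut if the weak closure of each member of $\mathcal{L}_X$ is small and closed; paracompact if there exists a locally finite subfamily of $\mathcal{L}_X$ covering $X$; Lindelöf if there exists a countable admissible subfamily of $\mathcal{L}_X$ covering $X$. *)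

theory Defs
  imports "HOL-Analysis.Analysis"
begin

text \<open>A family of sets is rendered as a set of sets.\<close>

locale locally_small_space =
  fixes X :: "'a set" and \<L> :: "'a set set"
  assumes subset_Pow: "\<L> \<subseteq> Pow X"
    and empty_in: "{} \<in> \<L>"
    and Int_in: "L \<in> \<L> \<Longrightarrow> M \<in> \<L> \<Longrightarrow> L \<inter> M \<in> \<L>"
    and Un_in: "L \<in> \<L> \<Longrightarrow> M \<in> \<L> \<Longrightarrow> L \<union> M \<in> \<L>"
    and Union_eq: "\<Union>\<L> = X"

definition lss_opens :: "'a set \<Rightarrow> 'a set set \<Rightarrow> 'a set set" where
  "lss_opens X \<L> = {V. V \<subseteq> X \<and> (\<forall>L\<in>\<L>. V \<inter> L \<in> \<L>)}"

definition lss_closed :: "'a set \<Rightarrow> 'a set set \<Rightarrow> 'a set \<Rightarrow> bool" where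
  "lss_closed X \<L> C \<longleftrightarrow> (\<exists>V\<in>lss_opens X \<L>. C = X - V)"

definition lss_small :: "'a set set \<Rightarrow> 'a set \<Rightarrow> bool" where
  "lss_small \<L> S \<longleftrightarrow> (\<exists>L\<in>\<L>. S \<subseteq> L)"

text \<open>The underlying set is not an argument: in a locally small space it is recovered as the
  space of this topology.\<close>

definition weak_topology :: "'a set set \<Rightarrow> 'a topology" where
  "weak_topology \<L> = topology (\<lambda>W. \<exists>\<U>\<subseteq>\<L>. W = \<Union>\<U>)"

definition weak_closure :: "'a set set \<Rightarrow> 'a set \<Rightarrow> 'a set" where
  "weak_closure \<L> Y = weak_topology \<L> closure_of Y"

definition lss_locally_finite :: "'a set \<Rightarrow> 'a set set \<Rightarrow> 'a set set \<Rightarrow> bool" where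
  "lss_locally_finite X \<L> \<U> \<longleftrightarrow>
     \<U> \<subseteq> lss_opens X \<L> \<and> (\<forall>L\<in>\<L>. finite {U \<in> \<U>. L \<inter> U \<noteq> {}})"

definition lss_admissible :: "'a set \<Rightarrow> 'a set set \<Rightarrow> 'a set set \<Rightarrow> bool" where
  "lss_admissible X \<L> \<U> \<longleftrightarrow>
     \<U> \<subseteq> lss_opens X \<L> \<and>
     (\<forall>L\<in>\<L>. \<exists>\<U>\<^sub>L. finite \<U>\<^sub>L \<and> \<U>\<^sub>L \<subseteq> \<U> \<and> \<Union>\<U> \<inter> L = \<Union>\<U>\<^sub>L \<inter> L)"

definition lss_strongly_taut :: "'a set \<Rightarrow> 'a set set \<Rightarrow> bool" where
  "lss_strongly_taut X \<L> \<longleftrightarrow>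
     (\<forall>L\<in>\<L>. lss_small \<L> (weak_closure \<L> L) \<and> lss_closed X \<L> (weak_closure \<L> L))"

definition lss_paracompact :: "'a set \<Rightarrow> 'a set set \<Rightarrow> bool" where
  "lss_paracompact X \<L> \<longleftrightarrow> (\<exists>\<U>\<subseteq>\<L>. lss_locally_finite X \<L> \<U> \<and> \<Union>\<U> = X)"

definition lss_Lindelof :: "'a set \<Rightarrow> 'a set set \<Rightarrow> bool" where
  "lss_Lindelof X \<L> \<longleftrightarrow> (\<exists>\<U>\<subseteq>\<L>. countable \<U> \<and> lss_admissible X \<L> \<U> \<and> \<Union>\<U> = X)"

context locally_small_space
begin

lemma istopology_weak: "istopology (\<lambda>W. \<exists>\<U>\<subseteq>\<L>. W = \<Union>\<U>)"
  unfolding istopology_def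
proof (intro conjI allI impI)
  fix S T
  assume "\<exists>\<U>\<subseteq>\<L>. S = \<Union>\<U>" and "\<exists>\<U>\<subseteq>\<L>. T = \<Union>\<U>"
  then obtain \<U> \<V> where *: "\<U> \<subseteq> \<L>" "S = \<Union>\<U>" "\<V> \<subseteq> \<L>" "T = \<Union>\<V>" by blast
  show "\<exists>\<U>\<subseteq>\<L>. S \<inter> T = \<Union>\<U>"
  proof (intro exI conjI)
    show "{U \<inter> V | U V. U \<in> \<U> \<and> V \<in> \<V>} \<subseteq> \<L>" using * Int_in by blast
    show "S \<inter> T = \<Union>{U \<inter> V | U V. U \<in> \<U> \<and> V \<in> \<V>}" using * by blast
  qed
next
  fix \<K>
  assume *: "\<forall>K\<in>\<K>. \<exists>\<U>\<subseteq>\<L>. K = \<Union>\<U>"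
  show "\<exists>\<U>\<subseteq>\<L>. \<Union>\<K> = \<Union>\<U>"
  proof (intro exI conjI)
    show "{U \<in> \<L>. U \<subseteq> \<Union>\<K>} \<subseteq> \<L>" by blast
    show "\<Union>\<K> = \<Union>{U \<in> \<L>. U \<subseteq> \<Union>\<K>}"
    proof
      show "\<Union>\<K> \<subseteq> \<Union>{U \<in> \<L>. U \<subseteq> \<Union>\<K>}"
      proof
        fix x assume "x \<in> \<Union>\<K>"
        then obtain K where K: "K \<in> \<K>" "x \<in> K" by blast
        with * obtain \<U> where U: "\<U> \<subseteq> \<L>" "K = \<Union>\<U>" by blast
        with K obtain U where "U \<in> \<U>" "x \<in> U" by blast
        with K U show "x \<in> \<Union>{U \<in> \<L>. U \<subseteq> \<Union>\<K>}" by blast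
      qed
    qed blast
  qed
qed

lemma openin_weak_topology: "openin (weak_topology \<L>) W \<longleftrightarrow> (\<exists>\<U>\<subseteq>\<L>. W = \<Union>\<U>)"
  by (simp add: weak_topology_def topology_inverse'[OF istopology_weak])

lemma topspace_weak_topology: "topspace (weak_topology \<L>) = X"
proof
  show "topspace (weak_topology \<L>) \<subseteq> X"
    unfolding topspace_def openin_weak_topology using Union_eq by blast
  have "openin (weak_topology \<L>) X" unfolding openin_weak_topology using Union_eq by blast
  then show "X \<subseteq> topspace (weak_topology \<L>)" by (rule openin_subset)
qed

end

end

theory Submission
  imports Defs
begin

text \<open>The proof transfers to locally small spaces the classical argument that a locally compact
  \<open>\<sigma>\<close>-compact Hausdorff space is paracompact, small open sets playing the role of relatively
  compact open sets. The Lindelof property gives countably many small open sets whose finite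
  unions swallow every small set, and strong tautness puts the weak closure of each small set
  into a small open set again. Alternating these two steps yields an exhaustion
  \<open>M 0 \<subseteq> M 1 \<subseteq> \<dots>\<close> of the space by small open sets such that the weak closure of \<open>M n\<close> lies
  in \<open>M (n + 1)\<close> and each small set lies in some \<open>M k\<close> (lemma \<open>strongly_taut_exhaustion\<close>).

  The shells \<open>M n - weak_closure (M (n - 2))\<close> are then small and open, because weak closures
  of small open sets are closed. They cover the space: a point that first appears in
  \<open>M n\<close> is outside \<open>M (n - 1)\<close> and hence outside the weak closure of \<open>M (n - 2)\<close>. They form a
  locally finite family, because \<open>M k\<close> misses all shells with \<open>n \<ge> k + 2\<close>.\<close>

context locally_small_space
begin

lemma subset_weak_closure: "L \<in> \<L> \<Longrightarrow> L \<subseteq> weak_closure \<L> L"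
  unfolding weak_closure_def
  by (rule closure_of_subset) (use subset_Pow in \<open>auto simp: topspace_weak_topology\<close>)

lemma members_open: "\<L> \<subseteq> lss_opens X \<L>"
  using subset_Pow Int_in by (auto simp: lss_opens_def)

lemma Diff_closed_in:
  assumes "L \<in> \<L>" "lss_closed X \<L> C"
  shows "L - C \<in> \<L>"
proof -
  obtain V where V: "V \<in> lss_opens X \<L>" "C = X - V"
    using assms(2) by (auto simp: lss_closed_def)
  have "L - C = V \<inter> L" using V assms(1) subset_Pow by auto
  then show ?thesis using V assms(1) by (auto simp: lss_opens_def)
qed

text \<open>Admissibility replaces the compactness argument of the classical setting: a small set is
  already covered by finitely many of the countably many sets, so it is swallowed after
  finitely many steps, whereas covering alone would only give this pointwise.\<close>

lemma strongly_taut_exhaustion: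
  assumes taut: "lss_strongly_taut X \<L>" and lind: "lss_Lindelof X \<L>"
  obtains M :: "nat \<Rightarrow> 'a set"
  where "incseq M" "M 0 = {}" "\<And>n. M n \<in> \<L>"
    "\<And>n. weak_closure \<L> (M n) \<subseteq> M (Suc n)" "\<And>L. L \<in> \<L> \<Longrightarrow> \<exists>k. L \<subseteq> M k"
proof -
  obtain \<U> where \<U>: "\<U> \<subseteq> \<L>" "countable \<U>" "lss_admissible X \<L> \<U>" "\<Union>\<U> = X"
    using lind by (auto simp: lss_Lindelof_def)
  \<comment> \<open>The empty set is added so that the family can be enumerated even if it is empty.\<close>
  define U where "U = from_nat_into (insert {} \<U>)"
  have range_U: "range U = insert {} \<U>"
    unfolding U_def using \<U>(2) by (intro range_from_nat_into) auto
  have U_in: "U n \<in> \<L>" for n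
  proof -
    have "U n \<in> insert {} \<U>" unfolding range_U[symmetric] by (rule rangeI)
    then show ?thesis using \<U>(1) empty_in by auto
  qed
  have "\<exists>M. \<forall>n. (M n \<in> \<L> \<and> (n = 0 \<longrightarrow> M n = {})) \<and>
      weak_closure \<L> (M n \<union> U n) \<subseteq> M (Suc n)"
  proof (rule dependent_nat_choice)
    fix K and n :: nat assume "K \<in> \<L> \<and> (n = 0 \<longrightarrow> K = {})"
    then have "K \<union> U n \<in> \<L>" using Un_in U_in by blast
    then show "\<exists>N. (N \<in> \<L> \<and> (Suc n = 0 \<longrightarrow> N = {})) \<and> weak_closure \<L> (K \<union> U n) \<subseteq> N"
      using taut by (auto simp: lss_strongly_taut_def lss_small_def)
  qed (use empty_in in auto)
  then obtain M where M: "\<forall>n. (M n \<in> \<L> \<and> (n = 0 \<longrightarrow> M n = {})) \<and>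
      weak_closure \<L> (M n \<union> U n) \<subseteq> M (Suc n)" ..
  then have M0: "M 0 = {}" and M_in: "M n \<in> \<L>"
    and step: "weak_closure \<L> (M n \<union> U n) \<subseteq> M (Suc n)" for n by blast+
  have Un_step: "M n \<union> U n \<subseteq> M (Suc n)" for n
    using subset_weak_closure[OF Un_in[OF M_in U_in]] step by blast
  have mono: "incseq M" using Un_step by (intro incseq_SucI) blast
  show thesis
  proof (rule that[OF mono M0 M_in])
    show "weak_closure \<L> (M n) \<subseteq> M (Suc n)" for n
      using step[of n] closure_of_mono[of "M n" "M n \<union> U n"] by (auto simp: weak_closure_def)
    fix L assume L: "L \<in> \<L>"
    then obtain \<F> where \<F>: "finite \<F>" "\<F> \<subseteq> \<U>" "\<Union>\<U> \<inter> L = \<Union>\<F> \<inter> L"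
      using \<U>(3) by (auto simp: lss_admissible_def)
    have sub: "\<F> \<subseteq> range U" using \<F>(2) range_U by blast
    obtain I where I: "finite I" "\<F> = U ` I"
      using finite_subset_image[OF \<F>(1) sub] by blast
    obtain k where k: "\<forall>i\<in>I. i < k" using I(1) finite_nat_set_iff_bounded by blast
    have "U i \<subseteq> M k" if "i \<in> I" for i
      using Un_step[of i] incseqD[OF mono, of "Suc i" k] k that by (auto simp: Suc_le_eq)
    moreover have "L \<subseteq> \<Union>\<F>" using L \<F>(3) \<U>(4) subset_Pow by blast
    ultimately show "\<exists>k. L \<subseteq> M k" using I(2) by blast
  qed
qed

end

theorem theorem2p60:
  fixes X :: "'a set" and \<L> :: "'a set set"
  assumes "locally_small_space X \<L>"
    and "lss_strongly_taut X \<L>"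
    and "lss_Lindelof X \<L>"
  shows "lss_paracompact X \<L>"
proof -
  interpret locally_small_space X \<L> by fact
  obtain M :: "nat \<Rightarrow> 'a set" where mono: "incseq M" and M0: "M 0 = {}"
    and M_in: "\<And>n. M n \<in> \<L>" and cl: "\<And>n. weak_closure \<L> (M n) \<subseteq> M (Suc n)"
    and swallow: "\<And>L. L \<in> \<L> \<Longrightarrow> \<exists>k. L \<subseteq> M k"
    by (rule strongly_taut_exhaustion[OF assms(2,3)]) (rule that)
  \<comment> \<open>The truncated \<open>n - 2\<close> is harmless: for \<open>n < 2\<close> the set removed is the weak closure
    of \<open>M 0 = {}\<close>, which is empty.\<close>
  define V where "V n = M n - weak_closure \<L> (M (n - 2))" for n
  have V_in: "range V \<subseteq> \<L>"
    unfolding V_def using Diff_closed_in M_in assms(2) by (auto simp: lss_strongly_taut_def)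
  have locally_finite: "finite {W \<in> range V. L \<inter> W \<noteq> {}}" if "L \<in> \<L>" for L
  proof -
    obtain k where k: "L \<subseteq> M k" using swallow \<open>L \<in> \<L>\<close> by blast
    have "L \<inter> V n = {}" if "k + 2 \<le> n" for n
    proof -
      have "M k \<subseteq> M (n - 2)" using that by (intro incseqD[OF mono]) simp
      then show ?thesis using k subset_weak_closure[OF M_in, of "n - 2"] by (auto simp: V_def)
    qed
    then have "{W \<in> range V. L \<inter> W \<noteq> {}} \<subseteq> V ` {..<k + 2}" by (force simp: not_le)
    then show ?thesis using finite_subset by blast
  qed
  have "X \<subseteq> \<Union>(range V)"
  proof
    fix x assume "x \<in> X"
    then have ex: "\<exists>n. x \<in> M n" using Union_eq swallow by blast
    define n where "n = (LEAST n. x \<in> M n)"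
    have x_in: "x \<in> M n" unfolding n_def by (rule LeastI_ex[OF ex])
    have x_notin: "x \<notin> M m" if "m < n" for m using that not_less_Least n_def by blast
    have "x \<notin> weak_closure \<L> (M (n - 2))"
    proof (cases "n < 2")
      case True
      then show ?thesis by (simp add: M0 weak_closure_def)
    next
      case False
      then have "x \<notin> M (Suc (n - 2))" by (intro x_notin) simp
      then show ?thesis using cl by blast
    qed
    then show "x \<in> \<Union>(range V)" using x_in by (auto simp: V_def)
  qed
  then have "\<Union>(range V) = X" using V_in subset_Pow by blast
  then show ?thesis
    using V_in members_open locally_finite
    by (auto simp: lss_paracompact_def lss_locally_finite_def intro!: exI[of _ "range V"])
qed

end
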